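(* Let $E$ be a Polish space, let $q\in(1,\infty)$, and let $p=q/(q-1)$. Let $\mu\in\mathcal{P}(E)$, and suppose $\int_E\psi^q\,d\mu<\infty$ for some continuous $\psi:E\to[0,\infty)$. Then, for every closed set $A\subset\mathcal{P}_\psi(E)$ (closed in the $\psi$-weak topology), $$\limsup_{n\to\infty}\,n^{q-1}\mu^n(L_n\in A)\le\Big(\inf_{\nu\in A}\|d\nu/d\mu\|_{L^p(\mu)}-1\Big)^{-q}.$$
   Context: $\mathcal{P}(E)$ is the set of Borel probability measures on $E$. $\mathcal{P}_\psi(E)=\{\nu\in\mathcal{P}(E):\int\psi\,d\nu<\infty\}$, equipped with the $\psi$-weak topology, i.e. the topology generated by the maps $\nu\mapsto\int f\,d\nu$ with $f:E\to\mathbb{R}$ continuous and $|f|\le1+\psi$. $\mu^n$ is the $n$-fold product measure on $E^n$, and $L_n:E^n\to\mathcal{P}(E)$ is $L_n(x_1,\dots,x_n)=\frac1n\sum_{i=1}^n\delta_{x_i}$ (which takes values in $\mathcal{P}_\psi(E)$). $\|d\nu/d\mu\|_{L^p(\mu)}=(\int|d\nu/d\mu|^p\,d\mu)^{1/p}\in[1,\infty]$ for $\nu\ll\mu$, and it is interpreted as $\infty$ when $\nu\not\ll\mu$. Conventions: $\inf\emptyset=\infty$, $0^{-q}=\infty$, $\infty^{-q}=0$. *)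

theory Defs
  imports "HOL-Probability.Probability"
begin

definition borel_probs :: "'a::topological_space measure set" where
  "borel_probs = {\<nu>. prob_space \<nu> \<and> sets \<nu> = sets borel}"

definition probs_psi :: "('a::topological_space \<Rightarrow> real) \<Rightarrow> 'a measure set" where
  "probs_psi \<psi> = {\<nu> \<in> borel_probs. (\<integral>\<^sup>+ x. ennreal (\<psi> x) \<partial>\<nu>) < \<infinity>}"

(* The topspace of this topology is probs_psi: choose f = 0 and U = UNIV. *)
definition psi_weak_topology ::
    "('a::topological_space \<Rightarrow> real) \<Rightarrow> 'a measure topology" where
  "psi_weak_topology \<psi> =
     topology_generated_by
       {{\<nu> \<in> probs_psi \<psi>. (\<integral>x. f x \<partial>\<nu>) \<in> U} | f U.
          continuous_on UNIV f \<and> (\<forall>x. \<bar>f x\<bar> \<le> 1 + \<psi> x) \<and> open (U :: real set)}"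

(* (1/n) * (delta_{x 0} + ... + delta_{x (n - 1)}), where return borel y is the Dirac measure
   at y.  Only meaningful for n > 0. *)
definition empirical_measure ::
    "nat \<Rightarrow> (nat \<Rightarrow> 'a::topological_space) \<Rightarrow> 'a measure" where
  "empirical_measure n x =
     measure_of UNIV (sets borel)
       (\<lambda>B. (\<Sum>i<n. emeasure (return borel (x i)) B) / of_nat n)"

(* measure_of would silently give the zero measure if the set function were not
   countably additive; this lemma excludes that. *)
lemma emeasure_empirical_measure:
  assumes "n > 0" "B \<in> sets borel"
  shows "emeasure (empirical_measure n x) B
           = (\<Sum>i<n. emeasure (return borel (x i)) B) / of_nat n"
proof -
  let ?f = "\<lambda>B. (\<Sum>i<n. emeasure (return borel (x i)) B) / of_nat n"
  have ca: "countably_additive (sets borel) ?f"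
  proof (rule countably_additiveI)
    fix A :: "nat \<Rightarrow> 'a set"
    assume A: "range A \<subseteq> sets borel" "disjoint_family A"
    have "(\<Sum>j. ?f (A j))
        = (\<Sum>j. \<Sum>i<n. emeasure (return borel (x i)) (A j)) / of_nat n"
      by (simp add: divide_ennreal_def ennreal_suminf_multc)
    also have "\<dots> = (\<Sum>i<n. \<Sum>j. emeasure (return borel (x i)) (A j)) / of_nat n"
      by (subst suminf_sum) simp_all
    also have "\<dots> = ?f (\<Union>j. A j)"
      using A by (subst suminf_emeasure) simp_all
    finally show "(\<Sum>j. ?f (A j)) = ?f (\<Union>j. A j)" .
  qed
  show ?thesis
  proof (rule emeasure_measure_of[OF empirical_measure_def])
    show "positive (sets (empirical_measure n x)) ?f"
      by (simp add: positive_def)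
    show "countably_additive (sets (empirical_measure n x)) ?f"
      using ca sets.sigma_sets_eq[of "borel :: 'a measure"]
      by (simp add: empirical_measure_def)
    show "B \<in> sets (empirical_measure n x)"
      using assms sets.sigma_sets_eq[of "borel :: 'a measure"]
      by (simp add: empirical_measure_def)
  qed simp
qed

(* Real powers on [0,\<infinity>], including 0 powr (-q) = \<infinity> and \<infinity> powr (-q) = 0 for q > 0,
   in contrast to powr on the reals. *)
definition ennpowr :: "ennreal \<Rightarrow> real \<Rightarrow> ennreal" where
  "ennpowr x r =
     (if r = 0 then 1
      else if x = 0 then (if r > 0 then 0 else \<infinity>)
      else if x = \<infinity> then (if r > 0 then \<infinity> else 0)
      else ennreal (enn2real x powr r))"

(* The L^p(\<mu>) norm of d\<nu>/d\<mu>; absolutely_continuous \<mu> \<nu> means \<nu> << \<mu>. *)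
definition density_Lp_norm :: "real \<Rightarrow> 'a measure \<Rightarrow> 'a measure \<Rightarrow> ennreal" where
  "density_Lp_norm p \<mu> \<nu> =
     (if absolutely_continuous \<mu> \<nu>
      then ennpowr (\<integral>\<^sup>+ x. ennpowr (RN_deriv \<mu> \<nu> x) p \<partial>\<mu>) (1 / p)
      else \<infinity>)"

end

theory Submission
  imports Defs "HOL-Real_Asymp.Real_Asymp"
begin

text \<open>
  The bound splits into two cases, according to whether \<open>\<mu>\<close> belongs to \<open>A\<close>.

  If \<open>\<mu> \<in> A\<close>, then \<open>\<nu> = \<mu>\<close> has density norm \<open>1\<close>, so the infimum is at most \<open>1\<close> and the
  right-hand side is the power of \<open>0\<close> with exponent \<open>- q\<close>, that is, \<open>\<infinity>\<close>.

  If \<open>\<mu> \<notin> A\<close>, then the left-hand side is \<open>0\<close>. The complement of \<open>A\<close> is a neighbourhood of \<open>\<mu>\<close>,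
  so on the event that the empirical measure \<open>L\<^sub>n\<close> lies in \<open>A\<close> one of finitely many test functions \<open>f\<close>
  has an empirical mean that deviates from \<open>\<integral> f d\<mu>\<close> by at least some fixed \<open>e > 0\<close>. Each \<open>f\<close>
  satisfies \<open>\<bar>f\<bar> \<le> 1 + \<psi>\<close> and so has a finite moment of order \<open>q\<close>. For i.i.d. variables with such
  a moment the deviation probability is not just \<open>O(n powr (1 - q))\<close> but \<open>o(n powr (1 - q))\<close>;
  this is a weak form of the Baum-Katz theorem, proved in
  \<open>powr_mult_iid_sum_tail_tendsto_0\<close>.

  The deviation estimate holds because a large sum \<open>S\<^sub>n \<ge> n e\<close> has two possible causes. Either one
  summand exceeds \<open>d n\<close>, which has probability at most \<open>n\<close> times the tail of a single variable, and
  that is \<open>o(n powr (1 - q))\<close> by dominated convergence. Or the summands truncated at \<open>d n\<close> still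
  add up to \<open>n e\<close>; the exponential Markov inequality with parameter of order \<open>ln n / n\<close> makes this
  smaller than any prescribed power of \<open>n\<close>, provided \<open>d\<close> is small enough.
\<close>

section \<open>Tails of sums of i.i.d. variables with a finite moment\<close>

text \<open>A second-order expansion of \<open>exp\<close> whose remainder involves only the power \<open>r \<le> 2\<close>, so that it can
  be integrated when second moments are infinite. The exponential factor grows only to the right,
  which is why truncation from above suffices below.\<close>
lemma exp_le_second_order_powr:
  fixes u r :: real
  assumes "1 < r" "r \<le> 2"
  shows "exp u \<le> 1 + u + \<bar>u\<bar> powr r * exp (max u 0)"
proof (cases "\<bar>u\<bar> \<le> 1")
  case True
  \<comment> \<open>For small \<open>u\<close> the quadratic remainder is dominated by the lower power.\<close>
  have "u\<^sup>2 \<le> \<bar>u\<bar> powr r"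
  proof (cases "u = 0")
    case False
    then have "\<bar>u\<bar> powr 2 \<le> \<bar>u\<bar> powr r"
      using True assms by (intro powr_mono') auto
    then show ?thesis using False by (simp add: powr_numeral)
  qed simp
  moreover have "exp u \<le> 1 + u + u\<^sup>2"
  proof (cases "u \<ge> 0")
    case True
    then show ?thesis using exp_bound[of u] \<open>\<bar>u\<bar> \<le> 1\<close> by simp
  next
    case False
    have "exp u * (1 - u) \<le> exp u * exp (- u)"
      using exp_ge_add_one_self[of "- u"] by (intro mult_left_mono) auto
    also have "\<dots> = 1" by (simp add: exp_minus)
    also have "1 \<le> 1 + (- u) ^ 3"
      using False by simp
    also have "\<dots> = (1 + u + u\<^sup>2) * (1 - u)" by algebra
    finally show ?thesis using False by (subst (asm) mult_le_cancel_right) auto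
  qed
  moreover have "\<bar>u\<bar> powr r * 1 \<le> \<bar>u\<bar> powr r * exp (max u 0)"
    by (intro mult_left_mono) auto
  ultimately show ?thesis by simp
next
  case False
  \<comment> \<open>For \<open>\<bar>u\<bar> > 1\<close> the remainder alone absorbs \<open>exp u\<close> on the right and the linear term on the left.\<close>
  have 1: "\<bar>u\<bar> \<le> \<bar>u\<bar> powr r"
    using powr_mono[of 1 r "\<bar>u\<bar>"] False assms by simp
  show ?thesis
  proof (cases "u \<ge> 0")
    case True
    have "1 * exp u \<le> (1 + u) + \<bar>u\<bar> powr r * exp u"
      using 1 False True by (intro add_increasing mult_right_mono) auto
    moreover have "max u 0 = u" using True by simp
    ultimately show ?thesis using True by simp
  next
    case neg: False
    then have "exp u \<le> 1" by simp
    also have "1 \<le> 1 + u + \<bar>u\<bar> powr r * exp (max u 0)"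
      using 1 neg by (simp add: max_def)
    finally show ?thesis .
  qed
qed

text \<open>Truncating from above can only lower a nonpositive mean, so the first-order term of the expansion
  has nonpositive integral and only the remainder counts.\<close>
lemma integral_exp_min_le:
  fixes g :: "'a \<Rightarrow> real"
  assumes "prob_space M" and g: "integrable M g" and mean: "(\<integral>x. g x \<partial>M) \<le> 0"
    and r: "1 < r" "r \<le> 2" and gr: "integrable M (\<lambda>x. \<bar>g x\<bar> powr r)"
    and "0 \<le> t" "0 < l"
  shows "(\<integral>\<^sup>+x. ennreal (exp (l * min (g x) t)) \<partial>M)
    \<le> ennreal (exp (l powr r * exp (l * t) * (\<integral>x. \<bar>g x\<bar> powr r \<partial>M)))"
proof -
  interpret prob_space M by fact
  have [measurable]: "g \<in> borel_measurable M" using g by auto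
  have W: "integrable M (\<lambda>x. min (g x) t)"
    using g by (intro integrable_min) auto
  have "(\<integral>x. min (g x) t \<partial>M) \<le> (\<integral>x. g x \<partial>M)"
    using W g by (intro integral_mono) auto
  then have mean_W: "(\<integral>x. min (g x) t \<partial>M) \<le> 0" using mean by simp
  have E: "integrable M (\<lambda>x. exp (l * min (g x) t))"
  proof (rule integrable_const_bound[of _ "exp (l * t)"])
    show "AE x in M. norm (exp (l * min (g x) t)) \<le> exp (l * t)"
      using \<open>0 < l\<close> by (intro AE_I2) simp
  qed simp
  let ?c = "l powr r * exp (l * t)"
  have "(\<integral>x. exp (l * min (g x) t) \<partial>M) \<le> (\<integral>x. 1 + l * min (g x) t + ?c * \<bar>g x\<bar> powr r \<partial>M)"
  proof (rule integral_mono[OF E])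
    show "integrable M (\<lambda>x. 1 + l * min (g x) t + ?c * \<bar>g x\<bar> powr r)"
      using W gr by auto
    fix x
    let ?u = "l * min (g x) t"
    have "\<bar>?u\<bar> powr r \<le> l powr r * \<bar>g x\<bar> powr r"
    proof -
      have "\<bar>?u\<bar> \<le> l * \<bar>g x\<bar>"
        using assms by (auto simp: abs_mult min_def)
      then have "\<bar>?u\<bar> powr r \<le> (l * \<bar>g x\<bar>) powr r"
        using r by (intro powr_mono2) auto
      then show ?thesis using assms by (simp add: powr_mult)
    qed
    moreover have "exp (max ?u 0) \<le> exp (l * t)"
      using assms by (auto simp: max_def)
    ultimately have "\<bar>?u\<bar> powr r * exp (max ?u 0) \<le> (l powr r * \<bar>g x\<bar> powr r) * exp (l * t)"
      by (intro mult_mono) auto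
    then show "exp ?u \<le> 1 + ?u + ?c * \<bar>g x\<bar> powr r"
      using exp_le_second_order_powr[OF r, of ?u] by (simp add: mult_ac)
  qed
  also have "\<dots> = 1 + l * (\<integral>x. min (g x) t \<partial>M) + ?c * (\<integral>x. \<bar>g x\<bar> powr r \<partial>M)"
    using W gr by (simp add: prob_space)
  also have "\<dots> \<le> 1 + ?c * (\<integral>x. \<bar>g x\<bar> powr r \<partial>M)"
    using mean_W \<open>0 < l\<close> by (simp add: mult_le_0_iff)
  also have "\<dots> \<le> exp (?c * (\<integral>x. \<bar>g x\<bar> powr r \<partial>M))"
    by (rule exp_ge_add_one_self)
  finally show ?thesis
    by (subst nn_integral_eq_integral[OF E]) (auto intro: ennreal_leI)
qed

text \<open>The event is covered by the union of the events that a single summand exceeds the truncation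
  level \<open>t\<close>, and the event that the truncated sum is large. The first part is bounded by
  subadditivity, the second by the exponential Markov inequality with parameter \<open>l\<close>.\<close>
lemma iid_sum_tail_bound:
  fixes g :: "'a \<Rightarrow> real"
  assumes "prob_space M" and g: "integrable M g" and mean: "(\<integral>x. g x \<partial>M) \<le> 0"
    and r: "1 < r" "r \<le> 2" and gr: "integrable M (\<lambda>x. \<bar>g x\<bar> powr r)"
    and tl: "0 \<le> t" "0 < l"
  shows "emeasure (PiM {..<n} (\<lambda>_. M)) {x \<in> space (PiM {..<n} (\<lambda>_. M)). a \<le> (\<Sum>i<n. g (x i))}
    \<le> ennreal (real n * measure M {x \<in> space M. t < g x}
        + exp (- l * a + real n * (l powr r * exp (l * t) * (\<integral>x. \<bar>g x\<bar> powr r \<partial>M))))"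
proof -
  interpret prob_space M by fact
  interpret P: product_prob_space "\<lambda>_::nat. M" ..
  let ?P = "PiM {..<n} (\<lambda>_. M)"
  let ?K = "l powr r * exp (l * t) * (\<integral>x. \<bar>g x\<bar> powr r \<partial>M)"
  have [measurable]: "g \<in> borel_measurable M" using g by auto
  define B where "B = {x \<in> space M. t < g x}"
  have B[measurable]: "B \<in> sets M" unfolding B_def by measurable
  define C where "C i = {x \<in> space ?P. x i \<in> B}" for i
  define D where "D = {x \<in> space ?P. a \<le> (\<Sum>i<n. min (g (x i)) t)}"
  have C[measurable]: "C i \<in> sets ?P" if "i < n" for i
    unfolding C_def by measurable (use that in auto)
  have D[measurable]: "D \<in> sets ?P"
    unfolding D_def by measurable
  have CB: "emeasure ?P (C i) = ennreal (measure M B)" if "i < n" for i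
  proof -
    have "emeasure ?P (C i) = emeasure (distr ?P M (\<lambda>x. x i)) B"
      using that by (subst emeasure_distr) (auto simp: C_def intro!: arg_cong2[where f=emeasure])
    also have "distr ?P M (\<lambda>x. x i) = M"
      using that prob_space_axioms by (intro distr_PiM_component) auto
    finally show ?thesis by (simp add: emeasure_eq_measure)
  qed
  have mgf: "(\<integral>\<^sup>+x. (\<Prod>i<n. ennreal (exp (l * min (g (x i)) t))) \<partial>?P) \<le> ennreal (exp (real n * ?K))"
  proof -
    have "(\<integral>\<^sup>+x. (\<Prod>i<n. ennreal (exp (l * min (g (x i)) t))) \<partial>?P)
        = (\<Prod>i<n. \<integral>\<^sup>+x. ennreal (exp (l * min (g x) t)) \<partial>M)"
      by (rule P.product_nn_integral_prod) auto
    also have "\<dots> \<le> (\<Prod>i<n. ennreal (exp ?K))"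
      by (intro prod_mono_ennreal integral_exp_min_le assms)
    also have "\<dots> = ennreal (exp (real n * ?K))"
      by (simp add: ennreal_power exp_of_nat_mult)
    finally show ?thesis .
  qed
  have "emeasure ?P D \<le> ennreal (exp (- l * a + real n * ?K))"
  proof -
    have "emeasure ?P D = (\<integral>\<^sup>+x. indicator D x \<partial>?P)" by simp
    also have "\<dots> \<le> (\<integral>\<^sup>+x. ennreal (exp (- l * a)) * (\<Prod>i<n. ennreal (exp (l * min (g (x i)) t))) \<partial>?P)"
    proof (rule nn_integral_mono)
      fix x assume "x \<in> space ?P"
      have "(indicator D x :: real) \<le> exp (- l * a + (\<Sum>i<n. l * min (g (x i)) t))"
        using tl mult_left_mono[of a "\<Sum>i<n. min (g (x i)) t" l]
        by (auto simp: indicator_def D_def simp flip: sum_distrib_left)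
      also have "\<dots> = exp (- l * a) * (\<Prod>i<n. exp (l * min (g (x i)) t))"
        by (simp only: exp_add exp_sum finite_lessThan)
      finally have "ennreal (indicator D x) \<le> ennreal (\<dots>)" by (rule ennreal_leI)
      then show "indicator D x \<le> ennreal (exp (- l * a)) * (\<Prod>i<n. ennreal (exp (l * min (g (x i)) t)))"
        by (simp add: ennreal_indicator prod_ennreal ennreal_mult' prod_nonneg)
    qed
    also have "\<dots> = ennreal (exp (- l * a)) * (\<integral>\<^sup>+x. (\<Prod>i<n. ennreal (exp (l * min (g (x i)) t))) \<partial>?P)"
      by (intro nn_integral_cmult) measurable
    also have "\<dots> \<le> ennreal (exp (- l * a)) * ennreal (exp (real n * ?K))"
      using mgf by (rule mult_left_mono) simp
    also have "\<dots> = ennreal (exp (- l * a + real n * ?K))"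
      by (simp only: exp_add ennreal_mult' exp_ge_zero)
    finally show ?thesis .
  qed
  moreover have "emeasure ?P (\<Union>i<n. C i) \<le> ennreal (real n * measure M B)"
  proof -
    have "emeasure ?P (\<Union>i<n. C i) \<le> (\<Sum>i<n. emeasure ?P (C i))"
      using C by (intro emeasure_subadditive_finite) auto
    also have "\<dots> = ennreal (real n * measure M B)"
      by (simp add: CB ennreal_mult' ennreal_of_nat_eq_real_of_nat)
    finally show ?thesis .
  qed
  moreover have "emeasure ?P {x \<in> space ?P. a \<le> (\<Sum>i<n. g (x i))} \<le> emeasure ?P ((\<Union>i<n. C i) \<union> D)"
  proof (rule emeasure_mono)
    show "{x \<in> space ?P. a \<le> (\<Sum>i<n. g (x i))} \<subseteq> (\<Union>i<n. C i) \<union> D"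
    proof
      fix x assume x: "x \<in> {x \<in> space ?P. a \<le> (\<Sum>i<n. g (x i))}"
      show "x \<in> (\<Union>i<n. C i) \<union> D"
      proof (cases "\<exists>i<n. t < g (x i)")
        case True
        then show ?thesis using x by (auto simp: C_def B_def space_PiM)
      next
        case False
        then have "(\<Sum>i<n. min (g (x i)) t) = (\<Sum>i<n. g (x i))"
          by (intro sum.cong refl min_absorb1) (meson lessThan_iff not_less)
        then show ?thesis using x by (auto simp: D_def)
      qed
    qed
    show "(\<Union>i<n. C i) \<union> D \<in> sets ?P" using C D by auto
  qed
  moreover have "emeasure ?P ((\<Union>i<n. C i) \<union> D) \<le> emeasure ?P (\<Union>i<n. C i) + emeasure ?P D"
    using C D by (intro emeasure_subadditive) auto
  ultimately show ?thesis
    unfolding B_def[symmetric]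
    by (subst ennreal_plus) (auto intro: order_trans add_mono)
qed

text \<open>Markov's inequality only bounds this sequence. The integrand
  \<open>n powr q\<close> on \<open>{d n < g}\<close> is dominated by a multiple of \<open>\<bar>g\<bar> powr q\<close> and vanishes for large \<open>n\<close>
  at every point, so dominated convergence gives the limit \<open>0\<close>.\<close>
lemma powr_mult_measure_tail_tendsto_0:
  fixes g :: "'a \<Rightarrow> real"
  assumes "prob_space M" and [measurable]: "g \<in> borel_measurable M" and "0 < q"
    and gq: "integrable M (\<lambda>x. \<bar>g x\<bar> powr q)" and "0 < d"
  shows "(\<lambda>n. real n powr q * measure M {x \<in> space M. d * real n < g x}) \<longlonglongrightarrow> 0"
proof -
  interpret prob_space M by fact
  let ?s = "\<lambda>n x. real n powr q * indicator {x \<in> space M. d * real n < g x} x"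
  have "(\<lambda>n. \<integral>x. ?s n x \<partial>M) \<longlonglongrightarrow> (\<integral>x. 0 \<partial>M)"
  proof (rule integral_dominated_convergence[where w = "\<lambda>x. d powr (- q) * \<bar>g x\<bar> powr q"])
    show "integrable M (\<lambda>x. d powr (- q) * \<bar>g x\<bar> powr q)" using gq by simp
    show "AE x in M. (\<lambda>n. ?s n x) \<longlonglongrightarrow> 0"
    proof (rule AE_I2)
      fix x
      have "eventually (\<lambda>n. g x < d * real n) sequentially"
        using \<open>0 < d\<close> by real_asymp
      then have "eventually (\<lambda>n. ?s n x = 0) sequentially"
        by eventually_elim auto
      then show "(\<lambda>n. ?s n x) \<longlonglongrightarrow> 0" by (rule tendsto_eventually)
    qed
    fix n
    show "AE x in M. norm (?s n x) \<le> d powr (- q) * \<bar>g x\<bar> powr q"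
    proof (rule AE_I2)
      fix x
      show "norm (?s n x) \<le> d powr (- q) * \<bar>g x\<bar> powr q"
      proof (cases "d * real n < g x")
        case True
        have "(d * real n) powr q \<le> \<bar>g x\<bar> powr q"
          using True assms by (intro powr_mono2) auto
        then have "d powr (-q) * (d * real n) powr q \<le> d powr (-q) * \<bar>g x\<bar> powr q"
          by (intro mult_left_mono) auto
        moreover have "d powr (-q) * (d * real n) powr q = real n powr q"
          using \<open>0 < d\<close> by (simp add: powr_mult powr_minus)
        ultimately show ?thesis by (simp add: indicator_def)
      qed simp
    qed
  qed auto
  then show ?thesis by simp
qed

text \<open>The tail bound is used with truncation level \<open>t = d n\<close> and exponential parameter
  \<open>l = b ln n / n\<close>. The choice \<open>b = q / e\<close> turns \<open>exp (- l n e)\<close> into \<open>n powr (- q)\<close>, which beats the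
  factor \<open>n powr (q - 1)\<close>. The price is \<open>exp (l t) = n powr (b d)\<close> inside the correction
  \<open>n l powr r exp (l t)\<close>, of order \<open>(ln n) powr r n powr (1 - r + b d)\<close>; with
  \<open>b d = (r - 1) / 2\<close> it still tends to \<open>0\<close>.\<close>
lemma powr_mult_iid_sum_tail_tendsto_0:
  fixes g :: "'a \<Rightarrow> real"
  assumes M: "prob_space M" and g[measurable]: "g \<in> borel_measurable M"
    and gq: "integrable M (\<lambda>x. \<bar>g x\<bar> powr q)" and mean: "(\<integral>x. g x \<partial>M) \<le> 0"
    and q: "1 < q" and e: "0 < e"
  shows "(\<lambda>n. ennreal (real n powr (q - 1)) * emeasure (PiM {..<n} (\<lambda>_. M))
     {x \<in> space (PiM {..<n} (\<lambda>_. M)). real n * e \<le> (\<Sum>i<n. g (x i))}) \<longlonglongrightarrow> 0"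
proof -
  interpret prob_space M by fact
  define r where "r = min q 2"
  have r: "1 < r" "r \<le> 2" "r \<le> q" using q by (auto simp: r_def)
  have int: "integrable M (\<lambda>x. \<bar>g x\<bar> powr s)" if s: "1 \<le> s" "s \<le> q" for s
  proof (rule Bochner_Integration.integrable_bound[where f = "\<lambda>x. 1 + \<bar>g x\<bar> powr q"])
    show "integrable M (\<lambda>x. 1 + \<bar>g x\<bar> powr q)" using gq by simp
    have "\<bar>y\<bar> powr s \<le> 1 + \<bar>y\<bar> powr q" for y :: real
    proof (cases "\<bar>y\<bar> \<le> 1")
      case True
      then have "\<bar>y\<bar> powr s \<le> 1" using s by (intro powr_le1) auto
      then show ?thesis by (simp add: add_increasing2)
    next
      case False
      then have "\<bar>y\<bar> powr s \<le> \<bar>y\<bar> powr q" using s by (intro powr_mono) auto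
      then show ?thesis by simp
    qed
    then show "AE x in M. norm (\<bar>g x\<bar> powr s) \<le> norm (1 + \<bar>g x\<bar> powr q)"
      by (intro AE_I2) (auto simp: add_increasing)
  qed simp
  have ig: "integrable M g"
    using int[of 1] q integrable_norm_iff[OF g] by simp
  define C where "C = (\<integral>x. \<bar>g x\<bar> powr r \<partial>M)"
  define b where "b = q / e"
  define d where "d = (r - 1) / (2 * b)"
  have b: "0 < b" and d: "0 < d" using q e r by (auto simp: b_def d_def)
  \<comment> \<open>The tail bound multiplied by \<open>n powr (q - 1)\<close>, after inserting the parameters.\<close>
  define F where "F n = real n powr q * measure M {x \<in> space M. d * real n < g x}
     + exp (b powr r * C * (ln (real n) powr r * real n powr (- (r - 1) / 2))) / real n" for n :: nat
  have "F \<longlonglongrightarrow> 0"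
  proof -
    have "(\<lambda>n. ln (real n) powr r * real n powr (- (r - 1) / 2)) \<longlonglongrightarrow> 0"
      using r by real_asymp
    then have "(\<lambda>n. exp (b powr r * C * (ln (real n) powr r * real n powr (- (r - 1) / 2)))) \<longlonglongrightarrow> exp (b powr r * C * 0)"
      by (intro tendsto_intros)
    then have "(\<lambda>n. exp (b powr r * C * (ln (real n) powr r * real n powr (- (r - 1) / 2))) * inverse (real n)) \<longlonglongrightarrow> exp (b powr r * C * 0) * 0"
      by (intro tendsto_mult lim_inverse_n)
    then show ?thesis
      using tendsto_add[OF powr_mult_measure_tail_tendsto_0[OF M g _ gq d]] q
      unfolding F_def divide_inverse by simp
  qed
  then have lim: "(\<lambda>n. ennreal (F n)) \<longlonglongrightarrow> 0"
    using tendsto_ennrealI by fastforce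
  show ?thesis
  proof (rule tendsto_sandwich[OF _ _ tendsto_const lim])
    show "eventually (\<lambda>n. ennreal (real n powr (q - 1)) * emeasure (PiM {..<n} (\<lambda>_. M))
     {x \<in> space (PiM {..<n} (\<lambda>_. M)). real n * e \<le> (\<Sum>i<n. g (x i))} \<le> ennreal (F n)) sequentially"
      using eventually_gt_at_top[of 1]
    proof eventually_elim
      case (elim n)
      define l where "l = b * ln (real n) / real n"
      have l: "0 < l" using elim b by (simp add: l_def)
      have n: "0 < real n" using elim by simp
      have lt: "exp (l * (d * real n)) = real n powr ((r - 1) / 2)"
        using n b by (simp add: l_def d_def powr_def field_simps)
      have "real n * (l powr r * exp (l * (d * real n)) * C)
         = b powr r * C * (ln (real n) powr r * (real n powr 1 * (real n powr (-r) * real n powr ((r - 1) / 2))))"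
        unfolding lt using n b elim by (simp add: l_def powr_mult powr_divide powr_minus field_simps)
      also have "real n powr 1 * (real n powr (-r) * real n powr ((r - 1) / 2)) = real n powr (- (r - 1) / 2)"
        unfolding powr_add[symmetric] by (simp add: field_simps)
      finally have K: "real n * (l powr r * exp (l * (d * real n)) * C)
         = b powr r * C * (ln (real n) powr r * real n powr (- (r - 1) / 2))" .
      have le: "exp (- l * (real n * e)) = real n powr (- q)"
        using n e by (simp add: l_def b_def powr_def field_simps)
      have "emeasure (PiM {..<n} (\<lambda>_. M))
          {x \<in> space (PiM {..<n} (\<lambda>_. M)). real n * e \<le> (\<Sum>i<n. g (x i))}
        \<le> ennreal (real n * measure M {x \<in> space M. d * real n < g x}
        + exp (- l * (real n * e) + real n * (l powr r * exp (l * (d * real n)) * C)))"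
        unfolding C_def using d r l by (intro iid_sum_tail_bound M ig mean int) auto
      then have "ennreal (real n powr (q - 1)) * emeasure (PiM {..<n} (\<lambda>_. M))
          {x \<in> space (PiM {..<n} (\<lambda>_. M)). real n * e \<le> (\<Sum>i<n. g (x i))}
        \<le> ennreal (real n powr (q - 1)) * \<dots>"
        by (intro mult_left_mono) auto
      also have "\<dots> = ennreal (real n powr (q - 1) * (real n * measure M {x \<in> space M. d * real n < g x}
        + exp (- l * (real n * e) + real n * (l powr r * exp (l * (d * real n)) * C))))"
        by (subst ennreal_mult) auto
      also have "real n powr (q - 1) * (real n * measure M {x \<in> space M. d * real n < g x}
        + exp (- l * (real n * e) + real n * (l powr r * exp (l * (d * real n)) * C))) = F n"
        unfolding exp_add le K F_def using n
        by (simp add: powr_diff powr_minus field_simps)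
      finally show ?case .
    qed
  qed simp
qed

section \<open>Empirical measures\<close>

text \<open>The empirical measure is the law of a uniformly chosen entry of the sample. This makes the
  integration rules for image measures and finite uniform distributions applicable.\<close>
lemma empirical_measure_eq_distr_pmf:
  assumes "0 < n"
  shows "empirical_measure n x = distr (measure_pmf (pmf_of_set {..<n})) borel x"
proof (rule measure_eqI)
  show "sets (empirical_measure n x) = sets (distr (measure_pmf (pmf_of_set {..<n})) borel x)"
    using sets.sigma_sets_eq[of "borel :: 'a measure"] by (simp add: empirical_measure_def)
  fix B assume "B \<in> sets (empirical_measure n x)"
  then have B: "B \<in> sets borel"
    using sets.sigma_sets_eq[of "borel :: 'a measure"] by (simp add: empirical_measure_def)
  have "emeasure (empirical_measure n x) B = (\<Sum>i<n. indicator B (x i)) / of_nat n"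
    using assms B by (simp add: emeasure_empirical_measure)
  also have "\<dots> = (\<integral>\<^sup>+ i. indicator (x -` B) i \<partial>measure_pmf (pmf_of_set {..<n}))"
    using assms by (subst nn_integral_pmf_of_set) (auto simp: indicator_def)
  also have "\<dots> = emeasure (distr (measure_pmf (pmf_of_set {..<n})) borel x) B"
    using B by (simp add: emeasure_distr)
  finally show "emeasure (empirical_measure n x) B
    = emeasure (distr (measure_pmf (pmf_of_set {..<n})) borel x) B" .
qed

lemma empirical_measure_in_probs_psi:
  fixes \<psi> :: "'a::topological_space \<Rightarrow> real"
  assumes "0 < n" "continuous_on UNIV \<psi>"
  shows "empirical_measure n x \<in> probs_psi \<psi>"
proof -
  have [measurable]: "\<psi> \<in> borel_measurable borel"
    using assms by (intro borel_measurable_continuous_onI)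
  have "prob_space (distr (measure_pmf (pmf_of_set {..<n})) borel x)"
    by (intro measure_pmf.prob_space_distr) auto
  moreover have "(\<integral>\<^sup>+ y. ennreal (\<psi> y) \<partial>distr (measure_pmf (pmf_of_set {..<n})) borel x) < \<infinity>"
    using assms by (simp add: nn_integral_distr nn_integral_pmf_of_set lessThan_empty_iff ennreal_divide_eq_top_iff less_top[symmetric])
  ultimately show ?thesis
    using assms by (simp add: probs_psi_def borel_probs_def empirical_measure_eq_distr_pmf)
qed

lemma integral_empirical_measure:
  fixes f :: "'a::topological_space \<Rightarrow> real"
  assumes "0 < n" "f \<in> borel_measurable borel"
  shows "(\<integral>y. f y \<partial>empirical_measure n x) = (\<Sum>i<n. f (x i)) / real n"
  using assms
  by (simp add: empirical_measure_eq_distr_pmf integral_distr integral_pmf_of_set lessThan_empty_iff)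

section \<open>Concentration in the \<psi>-weak topology\<close>

lemma integrable_powr_of_abs_le_add:
  fixes f \<psi> :: "'a::topological_space \<Rightarrow> real"
  assumes \<mu>: "\<mu> \<in> borel_probs" and q: "1 \<le> q"
    and \<psi>: "continuous_on UNIV \<psi>" "\<And>x. 0 \<le> \<psi> x"
    and \<psi>q: "(\<integral>\<^sup>+ x. ennreal (\<psi> x powr q) \<partial>\<mu>) < \<infinity>"
    and f: "f \<in> borel_measurable borel" and fb: "\<And>x. \<bar>f x\<bar> \<le> c + \<psi> x"
  shows "integrable \<mu> (\<lambda>x. \<bar>f x\<bar> powr q)"
proof -
  interpret prob_space \<mu> using \<mu> by (simp add: borel_probs_def)
  have sets: "sets \<mu> = sets borel" using \<mu> by (simp add: borel_probs_def)
  have [measurable]: "\<psi> \<in> borel_measurable \<mu>" "f \<in> borel_measurable \<mu>"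
    using \<psi>(1) f measurable_cong_sets[OF sets refl] by (auto intro: borel_measurable_continuous_onI)
  have i: "integrable \<mu> (\<lambda>x. \<psi> x powr q)"
    using \<psi>q by (intro integrableI_bounded) auto
  show ?thesis
  proof (rule Bochner_Integration.integrable_bound)
    show "integrable \<mu> (\<lambda>x. (2 * \<bar>c\<bar>) powr q + 2 powr q * \<psi> x powr q)"
      using i by simp
    have "\<bar>f x\<bar> powr q \<le> (2 * \<bar>c\<bar>) powr q + 2 powr q * \<psi> x powr q" for x
    proof (cases "\<bar>c\<bar> \<le> \<psi> x")
      case True
      then have "\<bar>f x\<bar> \<le> 2 * \<psi> x" using fb[of x] by linarith
      then have "\<bar>f x\<bar> powr q \<le> (2 * \<psi> x) powr q" using q by (intro powr_mono2) auto
      then show ?thesis using \<psi>(2)[of x] by (simp add: powr_mult add_increasing)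
    next
      case False
      then have "\<bar>f x\<bar> \<le> 2 * \<bar>c\<bar>" using fb[of x] by linarith
      then have "\<bar>f x\<bar> powr q \<le> (2 * \<bar>c\<bar>) powr q" using q by (intro powr_mono2) auto
      then show ?thesis by (simp add: add_increasing2)
    qed
    then show "AE x in \<mu>. norm (\<bar>f x\<bar> powr q) \<le> norm ((2 * \<bar>c\<bar>) powr q + 2 powr q * \<psi> x powr q)"
      by (intro AE_I2) (auto simp: add_nonneg_nonneg)
  qed simp
qed

text \<open>The one-sided estimate applied to both \<open>f - m\<close> and \<open>m - f\<close>, where \<open>m\<close> is the mean of \<open>f\<close>.\<close>
lemma powr_mult_empirical_mean_deviation_tendsto_0:
  fixes f :: "'a::topological_space \<Rightarrow> real"
  assumes \<mu>: "\<mu> \<in> borel_probs" and q: "1 < q" and f[measurable]: "f \<in> borel_measurable borel"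
    and fq: "\<And>c. integrable \<mu> (\<lambda>x. \<bar>f x - c\<bar> powr q)" and e: "0 < e"
  shows "(\<lambda>n. ennreal (real n powr (q - 1)) * emeasure (PiM {..<n} (\<lambda>_. \<mu>))
    {x \<in> space (PiM {..<n} (\<lambda>_. \<mu>)). e \<le> \<bar>(\<Sum>i<n. f (x i)) / real n - (\<integral>y. f y \<partial>\<mu>)\<bar>}) \<longlonglongrightarrow> 0"
proof -
  interpret prob_space \<mu> using \<mu> by (simp add: borel_probs_def)
  have sets[measurable_cong]: "sets \<mu> = sets borel" using \<mu> by (simp add: borel_probs_def)
  let ?P = "\<lambda>n. PiM {..<n} (\<lambda>_::nat. \<mu>)"
  define m where "m = (\<integral>y. f y \<partial>\<mu>)"
  define U where "U n = {x \<in> space (?P n). real n * e \<le> (\<Sum>i<n. f (x i) - m)}" for n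
  define L where "L n = {x \<in> space (?P n). real n * e \<le> (\<Sum>i<n. m - f (x i))}" for n
  have [measurable]: "U n \<in> sets (?P n)" "L n \<in> sets (?P n)" for n
    unfolding U_def L_def by measurable
  have "integrable \<mu> f"
  proof (rule Bochner_Integration.integrable_bound)
    show "integrable \<mu> (\<lambda>x. 1 + \<bar>f x - 0\<bar> powr q)" using fq[of 0] by simp
    have "\<bar>y\<bar> \<le> 1 + \<bar>y\<bar> powr q" for y :: real
      using powr_mono[of 1 q "\<bar>y\<bar>"] q by (cases "\<bar>y\<bar> \<le> 1") (auto simp: add_increasing2)
    then show "AE x in \<mu>. norm (f x) \<le> norm (1 + \<bar>f x - 0\<bar> powr q)"
      by (intro AE_I2) (auto simp: add_nonneg_nonneg)
  qed simp
  then have "(\<integral>x. f x - m \<partial>\<mu>) = 0" "(\<integral>x. m - f x \<partial>\<mu>) = 0"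
    by (simp_all add: m_def prob_space)
  then have "(\<lambda>n. ennreal (real n powr (q - 1)) * emeasure (?P n) (U n)) \<longlonglongrightarrow> 0"
    "(\<lambda>n. ennreal (real n powr (q - 1)) * emeasure (?P n) (L n)) \<longlonglongrightarrow> 0"
    unfolding U_def L_def using fq[of m] q e
    by (auto intro!: powr_mult_iid_sum_tail_tendsto_0 prob_space_axioms simp: abs_minus_commute)
  from tendsto_add[OF this]
  have lim: "(\<lambda>n. ennreal (real n powr (q - 1)) * emeasure (?P n) (U n)
    + ennreal (real n powr (q - 1)) * emeasure (?P n) (L n)) \<longlonglongrightarrow> 0" by simp
  show ?thesis
  proof (rule tendsto_sandwich[OF _ _ tendsto_const lim])
    show "eventually (\<lambda>n. ennreal (real n powr (q - 1)) * emeasure (?P n)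
      {x \<in> space (?P n). e \<le> \<bar>(\<Sum>i<n. f (x i)) / real n - (\<integral>y. f y \<partial>\<mu>)\<bar>}
      \<le> ennreal (real n powr (q - 1)) * emeasure (?P n) (U n)
        + ennreal (real n powr (q - 1)) * emeasure (?P n) (L n)) sequentially"
      using eventually_gt_at_top[of 0]
    proof eventually_elim
      case (elim n)
      have "{x \<in> space (?P n). e \<le> \<bar>(\<Sum>i<n. f (x i)) / real n - m\<bar>} \<subseteq> U n \<union> L n"
        using elim by (auto simp: U_def L_def sum_subtractf abs_real_def field_simps split: if_splits)
      then have "emeasure (?P n) {x \<in> space (?P n). e \<le> \<bar>(\<Sum>i<n. f (x i)) / real n - m\<bar>}
        \<le> emeasure (?P n) (U n \<union> L n)" by (intro emeasure_mono) auto
      also have "\<dots> \<le> emeasure (?P n) (U n) + emeasure (?P n) (L n)"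
        by (intro emeasure_subadditive) auto
      finally show ?case
        unfolding m_def[symmetric] distrib_left[symmetric] by (intro mult_left_mono) auto
    qed
  qed simp
qed

text \<open>Induction over the generation of open sets: a subbasic set is a deviation event for a single test
  function, a finite intersection produces a union of exceptional events, and for a union one member
  containing \<open>\<mu>\<close> suffices. The exceptional events are described by measurable supersets \<open>B\<close>
  because the events \<open>L\<^sub>n \<notin> V\<close> themselves may fail to be measurable for general \<open>V\<close>.\<close>
lemma powr_mult_empirical_outside_nhd_tendsto_0:
  fixes \<mu> :: "'a::topological_space measure"
  assumes q: "1 < q" and \<mu>: "\<mu> \<in> borel_probs"
    and \<psi>: "continuous_on UNIV \<psi>" "\<And>x. 0 \<le> \<psi> x"
    and \<psi>q: "(\<integral>\<^sup>+ x. ennreal (\<psi> x powr q) \<partial>\<mu>) < \<infinity>"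
    and V: "openin (psi_weak_topology \<psi>) V" "\<mu> \<in> V"
  obtains B where "\<And>n. B n \<in> sets (PiM {..<n} (\<lambda>_. \<mu>))"
    and "\<And>n. 0 < n \<Longrightarrow> {x \<in> space (PiM {..<n} (\<lambda>_. \<mu>)). empirical_measure n x \<notin> V} \<subseteq> B n"
    and "(\<lambda>n. ennreal (real n powr (q - 1)) * emeasure (PiM {..<n} (\<lambda>_. \<mu>)) (B n)) \<longlonglongrightarrow> 0"
proof -
  interpret prob_space \<mu> using \<mu> by (simp add: borel_probs_def)
  have sets[measurable_cong]: "sets \<mu> = sets borel" using \<mu> by (simp add: borel_probs_def)
  let ?P = "\<lambda>n. PiM {..<n} (\<lambda>_::nat. \<mu>)"
  define negl where "negl B \<longleftrightarrow> (\<forall>n. B n \<in> sets (?P n)) \<and>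
    (\<lambda>n. ennreal (real n powr (q - 1)) * emeasure (?P n) (B n)) \<longlonglongrightarrow> 0" for B
  define covers where "covers B V \<longleftrightarrow>
    (\<forall>n>0. {x \<in> space (?P n). empirical_measure n x \<notin> V} \<subseteq> B n)" for B V
  have "\<exists>B. negl B \<and> covers B V"
    using V(1)[unfolded psi_weak_topology_def openin_topology_generated_by_iff] V(2)
  proof (induction rule: generate_topology_on.induct)
    case Empty
    then show ?case by simp
  next
    case (Int a b)
    then obtain B C where B: "negl B" "covers B a" and C: "negl C" "covers C b" by auto
    have "negl (\<lambda>n. B n \<union> C n)"
      unfolding negl_def
    proof (intro conjI allI)
      have lim: "(\<lambda>n. ennreal (real n powr (q - 1)) * emeasure (?P n) (B n)
        + ennreal (real n powr (q - 1)) * emeasure (?P n) (C n)) \<longlonglongrightarrow> 0"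
        using B(1) C(1) tendsto_add[of _ "0::ennreal" sequentially _ 0] by (simp add: negl_def)
      show "(\<lambda>n. ennreal (real n powr (q - 1)) * emeasure (?P n) (B n \<union> C n)) \<longlonglongrightarrow> 0"
      proof (rule tendsto_sandwich[OF _ _ tendsto_const lim])
        show "eventually (\<lambda>n. ennreal (real n powr (q - 1)) * emeasure (?P n) (B n \<union> C n)
          \<le> ennreal (real n powr (q - 1)) * emeasure (?P n) (B n)
          + ennreal (real n powr (q - 1)) * emeasure (?P n) (C n)) sequentially"
          using B(1) C(1) unfolding distrib_left[symmetric]
          by (intro always_eventually allI mult_left_mono emeasure_subadditive) (auto simp: negl_def)
      qed simp
    qed (use B(1) C(1) in \<open>auto simp: negl_def\<close>)
    moreover have "covers (\<lambda>n. B n \<union> C n) (a \<inter> b)"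
      using B(2) C(2) unfolding covers_def by blast
    ultimately show ?case by blast
  next
    case (UN K)
    then obtain k B where "k \<in> K" "negl B" "covers B k" by (metis UnionE)
    then show ?case unfolding covers_def by blast
  next
    case (Basis s)
    then obtain f U where s: "s = {\<nu> \<in> probs_psi \<psi>. (\<integral>x. f x \<partial>\<nu>) \<in> U}"
      and fc: "continuous_on UNIV f" and fb: "\<And>x. \<bar>f x\<bar> \<le> 1 + \<psi> x" and U: "open U" by blast
    have f[measurable]: "f \<in> borel_measurable borel"
      using fc by (rule borel_measurable_continuous_onI)
    obtain e where e: "0 < e" and eU: "\<And>y. dist y (\<integral>x. f x \<partial>\<mu>) < e \<Longrightarrow> y \<in> U"
      using U Basis(2) unfolding s open_dist by blast
    define B where "B n = {x \<in> space (?P n). e \<le> \<bar>(\<Sum>i<n. f (x i)) / real n - (\<integral>y. f y \<partial>\<mu>)\<bar>}" for n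
    have "integrable \<mu> (\<lambda>x. \<bar>f x - c\<bar> powr q)" for c
    proof (rule integrable_powr_of_abs_le_add[OF \<mu> _ \<psi> \<psi>q])
      show "\<bar>f x - c\<bar> \<le> (1 + \<bar>c\<bar>) + \<psi> x" for x using fb[of x] by linarith
    qed (use q in auto)
    then have "negl B"
      unfolding negl_def B_def using \<mu> q e
      by (auto intro!: powr_mult_empirical_mean_deviation_tendsto_0)
    moreover have "covers B s"
      unfolding covers_def
    proof (intro allI impI subsetI)
      fix n :: nat and x assume n: "0 < n"
        and x: "x \<in> {x \<in> space (?P n). empirical_measure n x \<notin> s}"
      then have "(\<Sum>i<n. f (x i)) / real n \<notin> U"
        using empirical_measure_in_probs_psi[OF n \<psi>(1)] integral_empirical_measure[OF n f]
        by (simp add: s)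
      then have "\<not> dist ((\<Sum>i<n. f (x i)) / real n) (\<integral>y. f y \<partial>\<mu>) < e"
        using eU by blast
      then show "x \<in> B n"
        using x by (simp add: B_def dist_real_def)
    qed
    ultimately show ?case by blast
  qed
  then show thesis using that unfolding negl_def covers_def by blast
qed

lemma mem_topspace_psi_weak_topology:
  assumes \<mu>: "\<mu> \<in> borel_probs" and q: "1 < q"
    and \<psi>: "continuous_on UNIV \<psi>" "\<And>x. 0 \<le> \<psi> x"
    and \<psi>q: "(\<integral>\<^sup>+ x. ennreal (\<psi> x powr q) \<partial>\<mu>) < \<infinity>"
  shows "\<mu> \<in> topspace (psi_weak_topology \<psi>)"
proof -
  interpret prob_space \<mu> using \<mu> by (simp add: borel_probs_def)
  have [measurable_cong]: "sets \<mu> = sets borel" using \<mu> by (simp add: borel_probs_def)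
  have [measurable]: "\<psi> \<in> borel_measurable borel"
    using \<psi> by (intro borel_measurable_continuous_onI)
  have "(\<integral>\<^sup>+ x. ennreal (\<psi> x) \<partial>\<mu>) \<le> (\<integral>\<^sup>+ x. 1 + ennreal (\<psi> x powr q) \<partial>\<mu>)"
  proof (rule nn_integral_mono)
    fix x
    have "\<psi> x \<le> 1 + \<psi> x powr q"
      using powr_mono[of 1 q "\<psi> x"] q \<psi>(2)[of x] by (cases "\<psi> x \<le> 1") (auto simp: add_increasing2)
    then show "ennreal (\<psi> x) \<le> 1 + ennreal (\<psi> x powr q)"
      by (simp add: ennreal_leI flip: ennreal_1 ennreal_plus)
  qed
  also have "\<dots> = 1 + (\<integral>\<^sup>+ x. ennreal (\<psi> x powr q) \<partial>\<mu>)"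
    by (subst nn_integral_add) (auto simp: emeasure_space_1)
  also have "\<dots> < \<infinity>" using \<psi>q by simp
  finally have "\<mu> \<in> probs_psi \<psi>" using \<mu> by (simp add: probs_psi_def)
  moreover have "probs_psi \<psi> \<in> {{\<nu> \<in> probs_psi \<psi>. (\<integral>x. f x \<partial>\<nu>) \<in> U} | f U.
      continuous_on UNIV f \<and> (\<forall>x. \<bar>f x\<bar> \<le> 1 + \<psi> x) \<and> open (U :: real set)}"
    \<comment> \<open>The whole space is the subbasic set given by \<open>f = 0\<close> and \<open>U = UNIV\<close>.\<close>
    using \<psi>(2) by (intro CollectI exI[of _ "\<lambda>_. 0"] exI[of _ UNIV]) (auto simp: add_nonneg_nonneg)
  ultimately show ?thesis
    unfolding psi_weak_topology_def topology_generated_by_topspace by (rule UnionI[rotated])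
qed

section \<open>The upper bound\<close>

lemma density_Lp_norm_self:
  assumes "\<mu> \<in> borel_probs"
  shows "density_Lp_norm p \<mu> \<mu> = 1"
proof -
  interpret prob_space \<mu> using assms by (simp add: borel_probs_def)
  have "AE x in \<mu>. RN_deriv \<mu> \<mu> x = 1"
    using RN_deriv_unique[of "\<lambda>_. 1" \<mu>] by (simp add: density_1 eq_commute[of "1::ennreal"])
  then have "(\<integral>\<^sup>+ x. ennpowr (RN_deriv \<mu> \<mu> x) p \<partial>\<mu>) = (\<integral>\<^sup>+ x. 1 \<partial>\<mu>)"
    by (intro nn_integral_cong_AE) (auto simp: ennpowr_def elim!: eventually_mono)
  then show ?thesis
    by (simp add: density_Lp_norm_def absolutely_continuous_def ennpowr_def emeasure_space_1)
qed

theorem theorem1p2: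
  fixes \<mu> :: "'a::polish_space measure"
    and \<psi> :: "'a \<Rightarrow> real"
    and p q :: real
    and A :: "'a measure set"
  assumes "1 < q"
    and "p = q / (q - 1)"
    and "\<mu> \<in> borel_probs"
    and "continuous_on UNIV \<psi>"
    and "\<And>x. 0 \<le> \<psi> x"
    and "(\<integral>\<^sup>+ x. ennreal (\<psi> x powr q) \<partial>\<mu>) < \<infinity>"
    and "closedin (psi_weak_topology \<psi>) A"
  shows "limsup (\<lambda>n. ennreal (real n powr (q - 1)) *
           emeasure (PiM {..<n} (\<lambda>_. \<mu>))
             {x \<in> space (PiM {..<n} (\<lambda>_. \<mu>)). empirical_measure n x \<in> A})
         \<le> ennpowr ((INF \<nu>\<in>A. density_Lp_norm p \<mu> \<nu>) - 1) (- q)"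
proof (cases "\<mu> \<in> A")
  case True
  \<comment> \<open>The right-hand side is infinite.\<close>
  then have "(INF \<nu>\<in>A. density_Lp_norm p \<mu> \<nu>) \<le> 1"
    using density_Lp_norm_self[OF assms(3)] by (metis INF_lower)
  then have "(INF \<nu>\<in>A. density_Lp_norm p \<mu> \<nu>) - 1 = 0"
    by (simp add: diff_eq_0_iff_ennreal order.strict_trans1[OF _ ennreal_one_less_top])
  then show ?thesis using assms(1) by (simp add: ennpowr_def)
next
  case False
  let ?P = "\<lambda>n. PiM {..<n} (\<lambda>_::nat. \<mu>)"
  \<comment> \<open>The complement of \<open>A\<close> is a neighbourhood of \<open>\<mu>\<close>, so the left-hand side tends to \<open>0\<close>.\<close>
  let ?V = "topspace (psi_weak_topology \<psi>) - A"
  have open_V: "openin (psi_weak_topology \<psi>) ?V"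
    using assms(7) by (simp add: closedin_def)
  have mu_V: "\<mu> \<in> ?V"
    using False mem_topspace_psi_weak_topology[OF assms(3,1,4-6)] by simp
  obtain B where B: "\<And>n. B n \<in> sets (?P n)"
    "\<And>n. 0 < n \<Longrightarrow> {x \<in> space (?P n). empirical_measure n x \<notin> ?V} \<subseteq> B n"
    and lim: "(\<lambda>n. ennreal (real n powr (q - 1)) * emeasure (?P n) (B n)) \<longlonglongrightarrow> 0"
    by (rule powr_mult_empirical_outside_nhd_tendsto_0[OF assms(1,3-6) open_V mu_V]) blast
  have "(\<lambda>n. ennreal (real n powr (q - 1)) *
      emeasure (?P n) {x \<in> space (?P n). empirical_measure n x \<in> A}) \<longlonglongrightarrow> 0"
  proof (rule tendsto_sandwich[OF _ _ tendsto_const lim])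
    show "eventually (\<lambda>n. ennreal (real n powr (q - 1)) *
      emeasure (?P n) {x \<in> space (?P n). empirical_measure n x \<in> A}
      \<le> ennreal (real n powr (q - 1)) * emeasure (?P n) (B n)) sequentially"
      using eventually_gt_at_top[of 0]
    proof eventually_elim
      case (elim n)
      have "{x \<in> space (?P n). empirical_measure n x \<in> A} \<subseteq> B n"
        using B(2)[OF elim] by auto
      then show ?case by (intro mult_left_mono emeasure_mono B(1)) auto
    qed
  qed simp
  then show ?thesis
    by (simp add: lim_imp_Limsup)
qed

end
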